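(* Let $\mathbb F$ be a field of characteristic $p\geq3$, let $(L,[\cdot,\cdot],(\cdot)^{[p]})$ be a restricted Lie algebra over $\mathbb F$, and let $(m_t,\omega_t)$ and $(m'_t,\omega'_t)$ be two equivalent restricted formal deformations of $(L,[\cdot,\cdot],(\cdot)^{[p]})$, with $m_t=\sum t^im_i$, $\omega_t=\sum t^i\omega_i$, $m'_t=\sum t^im'_i$, $\omega'_t=\sum t^i\omega'_i$. Then their infinitesimals $(m_1,\omega_1)$ and $(m_1',\omega_1')$ are in the same restricted cohomology class, that is, $(m_1'-m_1,\omega_1'-\omega_1)\in B^2_*(L,L)$.
   Context: Restricted Lie algebra over a field $\mathbb F$ of characteristic $p$: a Lie algebra $L$ with a map $(\cdot)^{[p]}:L\to L$ such that $(\lambda x)^{[p]}=\lambda^p x^{[p]}$; $[x,y^{[p]}]=[[\cdots[x,y],y],\cdots,y]$ ($p$ copies of $y$); $(x+y)^{[p]}=x^{[p]}+y^{[p]}+\sum_{i=1}^{p-1}s_i(x,y)$, where $i\,s_i(x,y)$ is the coefficient of $Z^{i-1}$ in $\mathrm{ad}^{p-1}_{Zx+y}(x)$. Notation: $[x_1,\dots,x_n]:=[[\cdots[x_1,x_2],x_3],\cdots,x_n]$. $L$ acts on itself by $x\cdot m=[x,m]$. $C^n_{CE}(L,L)$ is the space of alternating $n$-linear maps $L^n\to L$. $C^2_*(L,L)$ is the set of pairs $(\varphi,\omega)$ with $\varphi\in C^2_{CE}(L,L)$ and $\omega:L\to L$ a map having the $( * )$-property with respect to $\varphi$: $\omega(\lambda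 x)=\lambda^p\omega(x)$ and $$\omega(x+y)=\omega(x)+\omega(y)+\sum_{\substack{x_i\in\{x,y\}\\ x_1=x,\ x_2=y}}\frac1{\sharp\{x\}}\sum_{k=0}^{p-2}(-1)^k\,x_p\cdot x_{p-1}\cdots x_{p-k+1}\cdot\varphi([x_1,\dots,x_{p-k-1}],x_{p-k}),$$ where the outer sum is over $p$-tuples of symbols in $\{x,y\}$ with $x_1=x,x_2=y$, and $\sharp\{x\}$ is the number of $x_i$ equal to $x$. Restricted $2$-coboundaries: for a linear map $\psi:L\to L$, $d^1_*\psi=(d^1_{CE}\psi,\mathrm{ind}^1(\psi))$ with $d^1_{CE}\psi(x,y)=-\psi([x,y])+[x,\psi(y)]-[y,\psi(x)]$ and $\mathrm{ind}^1(\psi)(x)=-\psi(x^{[p]})+\mathrm{ad}_x^{p-1}(\psi(x))$; and $B^2_*(L,L)=\{d^1_*\psi:\psi\in\mathrm{Hom}_{\mathbb F}(L,L)\}$. Restricted formal deformation of $L$: a pair $m_t=\sum_{i\ge0}t^im_i:L\times L\to L[[t]]$, $\omega_t=\sum_{i\ge0}t^i\omega_i:L\to L[[t]]$ with $m_0=[\cdot,\cdot]$, $\omega_0=(\cdot)^{[p]}$, $(m_i,\omega_i)\in C^2_*(L,L)$ for $i\ge1$, such that, $m_t$ being extended to $L[[t]]$ by $m_t(\sum_i t^ix_i,\sum_jt^jy_j)=\sum_{i,j}t^{i+j}m_t(x_i,y_j)$, for all $x,y,z\in L$: $m_t(x,m_t(y,z))+m_t(y,m_t(z,x))+m_t(z,m_t(x,y))=0$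 and $m_t(x,\omega_t(y))=m_t(m_t(\cdots m_t(x,y),y),\cdots,y)$ ($p$ copies of $y$). Extension of $\omega_t$ to $L[[t]]$: it is extended recursively by $\omega_t(x+tu)=\omega_t(x)+t^p\omega_t(u)+\sum_{k=1}^{p-1}\tilde s_k(x,tu)$ for $x\in L$, $u\in L[[t]]$, where $k\,\tilde s_k(x,tu)$ is the coefficient of $Z^{k-1}$ in $\mathrm{ad}^{p-1}_{Zx+tu}(x)$ computed with the bracket $m_t$ (the recursion converges $t$-adically). Equivalence: $(m_t,\omega_t)$ and $(m_t',\omega_t')$ are equivalent if there is a formal automorphism $\phi_t=\sum_{i\ge0}t^i\phi_i$, with $\phi_i:L\to L$ linear and $\phi_0=\mathrm{id}$, extended to $L[[t]]$ by $\phi_t(\sum_i t^i x_i)=\sum_i t^i\phi_t(x_i)$, such that for all $x,y\in L$: $m'_t(\phi_t(x),\phi_t(y))=\phi_t(m_t(x,y))$ and $\omega'_t(\phi_t(x))=\phi_t(\omega_t(x))$. *)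

theory Defs
  imports "HOL-Computational_Algebra.Computational_Algebra"
begin

text \<open>
  A Lie algebra is given by its scalar multiplication \<open>scale\<close> and its bracket \<open>br\<close> on a type
  \<open>'b\<close>. The space \<open>L[[t]]\<close> is \<^typ>\<open>'b fps\<close>, with an element of \<open>L\<close> embedded by \<^const>\<open>fps_const\<close>,
  and \<open>V[Z]\<close> is \<open>V poly\<close>; both only use the additive structure of the coefficients.
\<close>

definition bilinear_map :: "('a::field \<Rightarrow> 'b::ab_group_add \<Rightarrow> 'b) \<Rightarrow> ('b \<Rightarrow> 'b \<Rightarrow> 'b) \<Rightarrow> bool" where
  "bilinear_map scale \<phi> \<longleftrightarrow>
     (\<forall>x. Vector_Spaces.linear scale scale (\<lambda>y. \<phi> x y)) \<and>
     (\<forall>y. Vector_Spaces.linear scale scale (\<lambda>x. \<phi> x y))"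

definition alternating_bilinear :: "('a::field \<Rightarrow> 'b::ab_group_add \<Rightarrow> 'b) \<Rightarrow> ('b \<Rightarrow> 'b \<Rightarrow> 'b) \<Rightarrow> bool" where
  "alternating_bilinear scale \<phi> \<longleftrightarrow> bilinear_map scale \<phi> \<and> (\<forall>x. \<phi> x x = 0)"

locale lie_algebra = vector_space scale
  for scale :: "'a::field \<Rightarrow> 'b::ab_group_add \<Rightarrow> 'b" +
  fixes br :: "'b \<Rightarrow> 'b \<Rightarrow> 'b"
  assumes alternating: "alternating_bilinear scale br"
    and jacobi: "br x (br y z) + br y (br z x) + br z (br x y) = 0"

text \<open>\<open>iter_bracket br [x\<^sub>1, \<dots>, x\<^sub>n] = [[\<cdots>[x\<^sub>1, x\<^sub>2], x\<^sub>3], \<cdots>, x\<^sub>n]\<close>, for \<open>n \<ge> 1\<close>.\<close>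

definition iter_bracket :: "('v \<Rightarrow> 'v \<Rightarrow> 'v) \<Rightarrow> 'v list \<Rightarrow> 'v" where
  "iter_bracket br xs = foldl br (hd xs) (tl xs)"

text \<open>The \<open>Z\<close>-bilinear extension of a bracket on \<open>V\<close> to \<open>V[Z]\<close>.\<close>

definition poly_bracket ::
  "('v::ab_group_add \<Rightarrow> 'v \<Rightarrow> 'v) \<Rightarrow> 'v poly \<Rightarrow> 'v poly \<Rightarrow> 'v poly" where
  "poly_bracket br f g =
     (\<Sum>i\<le>degree f. \<Sum>j\<le>degree g. monom (br (coeff f i) (coeff g j)) (i + j))"

text \<open>
  The element \<open>s\<^sub>i(x, y)\<close>: \<open>i s\<^sub>i(x, y)\<close> is the coefficient of \<open>Z\<^bsup>i-1\<^esup>\<close> in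
  \<open>ad\<^bsup>p-1\<^esup>(x)\<close>, where \<open>ad\<close> is that of \<open>Z x + y\<close>. It is only used for \<open>1 \<le> i \<le> p - 1\<close>,
  where \<open>i\<close> is invertible in the field. It is stated for an arbitrary \<open>V\<close> since it is
  needed both for \<open>L\<close> and for \<open>L[[t]]\<close>.
\<close>

definition s_term ::
  "nat \<Rightarrow> ('a::field \<Rightarrow> 'v::ab_group_add \<Rightarrow> 'v) \<Rightarrow> ('v \<Rightarrow> 'v \<Rightarrow> 'v) \<Rightarrow> nat \<Rightarrow> 'v \<Rightarrow> 'v \<Rightarrow> 'v" where
  "s_term p scale br i x y =
     scale (1 / of_nat i)
       (coeff ((poly_bracket br (monom x 1 + [:y:]) ^^ (p - 1)) [:x:]) (i - 1))"

locale restricted_lie_algebra = lie_algebra scale br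
  for scale :: "'a::field \<Rightarrow> 'b::ab_group_add \<Rightarrow> 'b" and br :: "'b \<Rightarrow> 'b \<Rightarrow> 'b" +
  fixes p :: nat and pmap :: "'b \<Rightarrow> 'b"
  assumes char_p: "CHAR('a) = p" and p_pos: "p > 0"
    and pmap_scale: "pmap (scale a x) = scale (a ^ p) (pmap x)"
    and br_pmap: "br x (pmap y) = iter_bracket br (x # replicate p y)"
    and pmap_add: "pmap (x + y) = pmap x + pmap y + (\<Sum>i=1..p-1. s_term p scale br i x y)"

text \<open>
  A tuple of symbols in \<open>{x, y}\<close> is a word \<open>w\<close> of booleans, \<^const>\<open>True\<close> standing for \<open>x\<close>, so that
  the number of occurrences of \<open>x\<close> makes sense also when \<open>x = y\<close> in \<open>L\<close>. With \<open>v = [x\<^sub>1, \<dots>, x\<^sub>p]\<close>,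
  the entry \<open>x\<^sub>i\<close> is \<open>v ! (i - 1)\<close>, and \<^const>\<open>fold\<close> over \<open>drop (p - k) v = [x\<^bsub>p-k+1\<^esub>, \<dots>, x\<^sub>p]\<close> lets
  \<open>x\<^bsub>p-k+1\<^esub>\<close> act first and \<open>x\<^sub>p\<close> last.
\<close>

definition symbol_words :: "nat \<Rightarrow> bool list set" where
  "symbol_words p = {w. length w = p \<and> w ! 0 = True \<and> w ! 1 = False}"

definition star_summand ::
  "nat \<Rightarrow> ('a::field \<Rightarrow> 'b::ab_group_add \<Rightarrow> 'b) \<Rightarrow> ('b \<Rightarrow> 'b \<Rightarrow> 'b) \<Rightarrow> ('b \<Rightarrow> 'b \<Rightarrow> 'b) \<Rightarrow> 'b list \<Rightarrow> 'b" where
  "star_summand p scale br \<phi> v =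
     (\<Sum>k=0..p-2. scale ((- 1) ^ k)
        (fold br (drop (p - k) v) (\<phi> (iter_bracket br (take (p - k - 1) v)) (v ! (p - k - 1)))))"

definition star_property ::
  "nat \<Rightarrow> ('a::field \<Rightarrow> 'b::ab_group_add \<Rightarrow> 'b) \<Rightarrow> ('b \<Rightarrow> 'b \<Rightarrow> 'b) \<Rightarrow> ('b \<Rightarrow> 'b \<Rightarrow> 'b) \<Rightarrow> ('b \<Rightarrow> 'b) \<Rightarrow> bool" where
  "star_property p scale br \<phi> \<omega> \<longleftrightarrow>
     (\<forall>a x. \<omega> (scale a x) = scale (a ^ p) (\<omega> x)) \<and>
     (\<forall>x y. \<omega> (x + y) = \<omega> x + \<omega> y +
        (\<Sum>w\<in>symbol_words p. scale (1 / of_nat (count_list w True))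
           (star_summand p scale br \<phi> (map (\<lambda>b. if b then x else y) w))))"

definition restricted_cochains2 ::
  "nat \<Rightarrow> ('a::field \<Rightarrow> 'b::ab_group_add \<Rightarrow> 'b) \<Rightarrow> ('b \<Rightarrow> 'b \<Rightarrow> 'b) \<Rightarrow> (('b \<Rightarrow> 'b \<Rightarrow> 'b) \<times> ('b \<Rightarrow> 'b)) set" where
  "restricted_cochains2 p scale br =
     {(\<phi>, \<omega>). alternating_bilinear scale \<phi> \<and> star_property p scale br \<phi> \<omega>}"

definition d1_CE :: "('b::ab_group_add \<Rightarrow> 'b \<Rightarrow> 'b) \<Rightarrow> ('b \<Rightarrow> 'b) \<Rightarrow> 'b \<Rightarrow> 'b \<Rightarrow> 'b" where
  "d1_CE br \<psi> x y = - \<psi> (br x y) + br x (\<psi> y) - br y (\<psi> x)"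

definition ind1 ::
  "nat \<Rightarrow> ('b::ab_group_add \<Rightarrow> 'b \<Rightarrow> 'b) \<Rightarrow> ('b \<Rightarrow> 'b) \<Rightarrow> ('b \<Rightarrow> 'b) \<Rightarrow> 'b \<Rightarrow> 'b" where
  "ind1 p br pmap \<psi> x = - \<psi> (pmap x) + (br x ^^ (p - 1)) (\<psi> x)"

definition restricted_coboundaries2 ::
  "nat \<Rightarrow> ('a::field \<Rightarrow> 'b::ab_group_add \<Rightarrow> 'b) \<Rightarrow> ('b \<Rightarrow> 'b \<Rightarrow> 'b) \<Rightarrow> ('b \<Rightarrow> 'b) \<Rightarrow>
     (('b \<Rightarrow> 'b \<Rightarrow> 'b) \<times> ('b \<Rightarrow> 'b)) set" where
  "restricted_coboundaries2 p scale br pmap =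
     {(d1_CE br \<psi>, ind1 p br pmap \<psi>) | \<psi>. Vector_Spaces.linear scale scale \<psi>}"

text \<open>
  A series \<open>m\<^sub>t = \<Sum> t\<^sup>i m\<^sub>i\<close> is represented by the sequence \<open>m\<close> of its coefficients, and similarly for
  \<open>\<omega>\<^sub>t\<close> and \<open>\<phi>\<^sub>t\<close>.
\<close>

definition bracket_ext ::
  "(nat \<Rightarrow> 'b::ab_group_add \<Rightarrow> 'b \<Rightarrow> 'b) \<Rightarrow> 'b fps \<Rightarrow> 'b fps \<Rightarrow> 'b fps" where
  "bracket_ext m f g =
     Abs_fps (\<lambda>n. \<Sum>i\<le>n. \<Sum>j\<le>n-i. m (n - i - j) (fps_nth f i) (fps_nth g j))"

definition linear_ext :: "(nat \<Rightarrow> 'b::ab_group_add \<Rightarrow> 'b) \<Rightarrow> 'b fps \<Rightarrow> 'b fps" where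
  "linear_ext \<phi> f = Abs_fps (\<lambda>n. \<Sum>i\<le>n. \<phi> (n - i) (fps_nth f i))"

definition omega_series :: "(nat \<Rightarrow> 'b \<Rightarrow> 'b) \<Rightarrow> 'b \<Rightarrow> 'b fps" where
  "omega_series \<omega> x = Abs_fps (\<lambda>n. \<omega> n x)"

definition restricted_deformation ::
  "nat \<Rightarrow> ('a::field \<Rightarrow> 'b::ab_group_add \<Rightarrow> 'b) \<Rightarrow> ('b \<Rightarrow> 'b \<Rightarrow> 'b) \<Rightarrow> ('b \<Rightarrow> 'b) \<Rightarrow>
     (nat \<Rightarrow> 'b \<Rightarrow> 'b \<Rightarrow> 'b) \<Rightarrow> (nat \<Rightarrow> 'b \<Rightarrow> 'b) \<Rightarrow> bool" where
  "restricted_deformation p scale br pmap m \<omega> \<longleftrightarrow>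
     m 0 = br \<and> \<omega> 0 = pmap \<and>
     (\<forall>i\<ge>1. (m i, \<omega> i) \<in> restricted_cochains2 p scale br) \<and>
     (\<forall>x y z. let X = fps_const x; Y = fps_const y; Z = fps_const z in
        bracket_ext m X (bracket_ext m Y Z) + bracket_ext m Y (bracket_ext m Z X)
          + bracket_ext m Z (bracket_ext m X Y) = 0) \<and>
     (\<forall>x y. bracket_ext m (fps_const x) (omega_series \<omega> y) =
        iter_bracket (bracket_ext m) (fps_const x # replicate p (fps_const y)))"

text \<open>Scalar multiplication on \<open>L[[t]]\<close>, and multiplication by \<open>t\<^sup>k\<close>.\<close>

definition fps_scale :: "('a \<Rightarrow> 'b \<Rightarrow> 'b) \<Rightarrow> 'a \<Rightarrow> 'b fps \<Rightarrow> 'b fps" where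
  "fps_scale scale a f = Abs_fps (\<lambda>n. scale a (fps_nth f n))"

definition t_power_mult :: "nat \<Rightarrow> 'b::zero fps \<Rightarrow> 'b fps" where
  "t_power_mult k f = Abs_fps (\<lambda>n. if n < k then 0 else fps_nth f (n - k))"

text \<open>
  The extension of \<open>\<omega>\<^sub>t\<close> to \<open>L[[t]]\<close> is computed coefficientwise: for \<open>f = x + t u\<close>, with
  \<open>x = fps_nth f 0\<close> and \<open>u = fps_shift 1 f\<close>, the summand \<open>t\<^sup>p \<omega>\<^sub>t(u)\<close> contributes to the coefficient of
  \<open>t\<^sup>n\<close> only when \<open>n \<ge> p\<close>, by the coefficient of \<open>t\<^bsup>n-p\<^esup>\<close> in \<open>\<omega>\<^sub>t(u)\<close>. The defining equation
  is \<open>omega_ext_rec\<close> below, and \<open>omega_ext_unique\<close> shows that it determines the extension.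
\<close>

definition omega_ext_head ::
  "nat \<Rightarrow> ('a::field \<Rightarrow> 'b::ab_group_add \<Rightarrow> 'b) \<Rightarrow> (nat \<Rightarrow> 'b \<Rightarrow> 'b \<Rightarrow> 'b) \<Rightarrow> (nat \<Rightarrow> 'b \<Rightarrow> 'b) \<Rightarrow>
     'b \<Rightarrow> 'b fps \<Rightarrow> 'b fps" where
  "omega_ext_head p scale m \<omega> x u =
     omega_series \<omega> x +
     (\<Sum>k=1..p-1. s_term p (fps_scale scale) (bracket_ext m) k (fps_const x) (t_power_mult 1 u))"

fun omega_ext_nth ::
  "nat \<Rightarrow> ('a::field \<Rightarrow> 'b::ab_group_add \<Rightarrow> 'b) \<Rightarrow> (nat \<Rightarrow> 'b \<Rightarrow> 'b \<Rightarrow> 'b) \<Rightarrow> (nat \<Rightarrow> 'b \<Rightarrow> 'b) \<Rightarrow>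
     'b fps \<Rightarrow> nat \<Rightarrow> 'b" where
  "omega_ext_nth p scale m \<omega> f n =
     fps_nth (omega_ext_head p scale m \<omega> (fps_nth f 0) (fps_shift 1 f)) n +
     (if 0 < p \<and> p \<le> n then omega_ext_nth p scale m \<omega> (fps_shift 1 f) (n - p) else 0)"

declare omega_ext_nth.simps [simp del]

definition omega_ext ::
  "nat \<Rightarrow> ('a::field \<Rightarrow> 'b::ab_group_add \<Rightarrow> 'b) \<Rightarrow> (nat \<Rightarrow> 'b \<Rightarrow> 'b \<Rightarrow> 'b) \<Rightarrow> (nat \<Rightarrow> 'b \<Rightarrow> 'b) \<Rightarrow>
     'b fps \<Rightarrow> 'b fps" where
  "omega_ext p scale m \<omega> f = Abs_fps (omega_ext_nth p scale m \<omega> f)"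

lemma fps_nth_t_power_mult:
  "fps_nth (t_power_mult k f) n = (if n < k then 0 else fps_nth f (n - k))"
  by (simp add: t_power_mult_def)

lemma split_const_t: "fps_nth (fps_const x + t_power_mult 1 u) 0 = x"
    "fps_shift 1 (fps_const x + t_power_mult 1 u) = u"
  for x :: "'b::ab_group_add"
  by (auto simp: fps_eq_iff t_power_mult_def)

lemma omega_ext_rec:
  assumes "p > 0"
  shows "omega_ext p scale m \<omega> (fps_const x + t_power_mult 1 u) =
    omega_series \<omega> x + t_power_mult p (omega_ext p scale m \<omega> u) +
    (\<Sum>k=1..p-1. s_term p (fps_scale scale) (bracket_ext m) k (fps_const x) (t_power_mult 1 u))"
proof (rule fps_ext)
  fix n
  show "fps_nth (omega_ext p scale m \<omega> (fps_const x + t_power_mult 1 u)) n = fps_nth (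
    omega_series \<omega> x + t_power_mult p (omega_ext p scale m \<omega> u) +
    (\<Sum>k=1..p-1. s_term p (fps_scale scale) (bracket_ext m) k (fps_const x) (t_power_mult 1 u))) n"
    using assms
    unfolding omega_ext_def fps_nth_Abs_fps
    by (subst omega_ext_nth.simps, unfold split_const_t)
      (simp add: omega_ext_head_def fps_nth_t_power_mult)
qed

lemma omega_ext_unique:
  assumes "p > 0"
    and rec: "\<And>x u. \<Omega> (fps_const x + t_power_mult 1 u) =
      omega_series \<omega> x + t_power_mult p (\<Omega> u) +
      (\<Sum>k=1..p-1. s_term p (fps_scale scale) (bracket_ext m) k (fps_const x) (t_power_mult 1 u))"
  shows "\<Omega> = omega_ext p scale m \<omega>"
proof -
  have "fps_nth (\<Omega> f) n = fps_nth (omega_ext p scale m \<omega> f) n" for f n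
  proof (induction n arbitrary: f rule: less_induct)
    case (less n)
    define x u where "x = fps_nth f 0" and "u = fps_shift 1 f"
    have f: "f = fps_const x + t_power_mult 1 u"
      by (auto simp: fps_eq_iff x_def u_def t_power_mult_def)
    show ?case
      unfolding f rec omega_ext_rec[OF assms(1)] using less[of "n - p" u] assms(1)
      by (auto simp: fps_nth_t_power_mult)
  qed
  then show ?thesis by (intro ext fps_ext)
qed

definition equivalent_deformations ::
  "nat \<Rightarrow> ('a::field \<Rightarrow> 'b::ab_group_add \<Rightarrow> 'b) \<Rightarrow>
     (nat \<Rightarrow> 'b \<Rightarrow> 'b \<Rightarrow> 'b) \<Rightarrow> (nat \<Rightarrow> 'b \<Rightarrow> 'b) \<Rightarrow>
     (nat \<Rightarrow> 'b \<Rightarrow> 'b \<Rightarrow> 'b) \<Rightarrow> (nat \<Rightarrow> 'b \<Rightarrow> 'b) \<Rightarrow> bool" where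
  "equivalent_deformations p scale m \<omega> m' \<omega>' \<longleftrightarrow>
     (\<exists>\<phi> :: nat \<Rightarrow> 'b \<Rightarrow> 'b.
        (\<forall>i. Vector_Spaces.linear scale scale (\<phi> i)) \<and> \<phi> 0 = id \<and>
        (\<forall>x y. bracket_ext m' (linear_ext \<phi> (fps_const x)) (linear_ext \<phi> (fps_const y)) =
           linear_ext \<phi> (bracket_ext m (fps_const x) (fps_const y))) \<and>
        (\<forall>x. omega_ext p scale m' \<omega>' (linear_ext \<phi> (fps_const x)) =
           linear_ext \<phi> (omega_series \<omega> x)))"

end

theory Submission
  imports Defs
begin

text \<open>
  The class of the infinitesimals changes by \<open>\<psi> = - \<phi>\<^sub>1\<close>: both components are obtained by comparing
  coefficients of \<open>t\<close> in the two equivalence equations. For the second one, write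
  \<open>\<phi>\<^sub>t(x) = x + t u\<close> with \<open>u \<equiv> \<phi>\<^sub>1(x)\<close> modulo \<open>t\<close>. Since \<open>m'\<^sub>t(x, x) = 0\<close>, the only monomial of
  \<open>ad\<^bsup>p-1\<^esup>(x)\<close>, with \<open>ad\<close> that of \<open>Z x + t u\<close>, that survives modulo \<open>t\<^sup>2\<close> is the one in which
  \<open>t u\<close> acts first; it is \<open>t Z\<^bsup>p-2\<^esup> ad\<^sub>x\<^bsup>p-2\<^esup>([\<phi>\<^sub>1 x, x])\<close>. So only \<open>s\<^bsub>p-1\<^esub>\<close> contributes, and
  \<open>1 / (p - 1) = - 1\<close> in the field turns it into \<open>t ad\<^sub>x\<^bsup>p-1\<^esup>(\<phi>\<^sub>1 x)\<close>.
\<close>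

lemma linear_map_zero: "Vector_Spaces.linear s1 s2 f \<Longrightarrow> f 0 = 0"
  by (simp add: linear_iff_module_hom module_hom.zero)

lemma linear_map_minus: "Vector_Spaces.linear s1 s2 f \<Longrightarrow> f (- x) = - f x"
  by (simp add: linear_iff_module_hom module_hom.neg)

lemma bilinear_map_zero:
  assumes "bilinear_map scale \<phi>"
  shows "\<phi> 0 y = 0" "\<phi> x 0 = 0"
  using assms linear_map_zero[of scale scale "\<lambda>x. \<phi> x y"] linear_map_zero[of scale scale "\<lambda>y. \<phi> x y"]
  by (auto simp: bilinear_map_def)

lemma bilinear_map_minus_right:
  assumes "bilinear_map scale \<phi>"
  shows "\<phi> x (- y) = - \<phi> x y"
  using assms linear_map_minus[of scale scale "\<lambda>y. \<phi> x y" y] by (auto simp: bilinear_map_def)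

lemma alternating_bilinear_skew:
  assumes "alternating_bilinear scale \<phi>"
  shows "\<phi> y x = - \<phi> x y"
proof -
  have add: "\<phi> (a + b) c = \<phi> a c + \<phi> b c" "\<phi> c (a + b) = \<phi> c a + \<phi> c b" for a b c
    using assms
      module_hom.add[of scale scale "\<lambda>v. \<phi> v c" a b] module_hom.add[of scale scale "\<phi> c" a b]
    by (auto simp: alternating_bilinear_def bilinear_map_def linear_iff_module_hom)
  have "0 = \<phi> (x + y) (x + y)"
    using assms by (simp add: alternating_bilinear_def)
  also have "\<dots> = \<phi> x y + \<phi> y x"
    using assms unfolding add by (simp add: alternating_bilinear_def)
  finally show ?thesis
    by (simp add: eq_neg_iff_add_eq_0 add.commute)
qed

text \<open>Because \<open>B\<close> vanishes as soon as one argument is 0, the degree bounds in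
  \<open>poly_bracket\<close> can be ignored. This also covers \<open>X = 0\<close>, where the
  linear polynomial Z X + Y drops to degree 0.\<close>

lemma coeff_poly_bracket_linear:
  assumes "\<And>v. B 0 v = 0" and "\<And>v. B v 0 = 0"
  shows "coeff (poly_bracket B (monom X 1 + [:Y:]) f) n =
    (if n = 0 then 0 else B X (coeff f (n - 1))) + B Y (coeff f n)"
proof -
  define l where "l = monom X 1 + [:Y:]"
  have deg: "degree l \<le> 1"
    unfolding l_def by (intro degree_add_le degree_monom_le) simp
  have l: "coeff l 0 = Y" "coeff l 1 = X"
    by (simp_all add: l_def)
  have "coeff (poly_bracket B l f) n =
      (\<Sum>i\<le>degree l. \<Sum>j\<le>degree f. if i + j = n then B (coeff l i) (coeff f j) else 0)"
    by (simp add: poly_bracket_def coeff_sum)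
  also have "\<dots> = (\<Sum>i\<le>degree l. if i \<le> n then B (coeff l i) (coeff f (n - i)) else 0)"
  proof (rule sum.cong[OF refl])
    fix i
    \<comment> \<open>For fixed \<open>i\<close> only \<open>j = n - i\<close> can contribute; the
      guard \<open>i \<le> n\<close> rules out the truncated subtraction. An index beyond
      \<open>degree f\<close> meets a zero coefficient.\<close>
    have "(\<Sum>j\<le>degree f. if i + j = n then B (coeff l i) (coeff f j) else 0) =
        (\<Sum>j\<le>degree f. if n - i = j then (if i \<le> n then B (coeff l i) (coeff f j) else 0) else 0)"
      by (intro sum.cong) auto
    also have "\<dots> = (if i \<le> n then B (coeff l i) (coeff f (n - i)) else 0)"
      by (subst sum.delta') (auto simp: assms coeff_eq_0)
    finally show "(\<Sum>j\<le>degree f. if i + j = n then B (coeff l i) (coeff f j) else 0) = \<dots>" .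
  qed
  also have "\<dots> = (\<Sum>i\<le>1. if i \<le> n then B (coeff l i) (coeff f (n - i)) else 0)"
    using deg by (intro sum.mono_neutral_left) (auto simp: assms coeff_eq_0)
  also have "\<dots> = (if n = 0 then 0 else B X (coeff f (n - 1))) + B Y (coeff f n)"
    using l by (simp add: atMost_Suc add.commute)
  finally show ?thesis
    by (simp only: l_def)
qed

lemma bracket_ext_nth_0: "fps_nth (bracket_ext m f g) 0 = m 0 (fps_nth f 0) (fps_nth g 0)"
  by (simp add: bracket_ext_def)

lemma bracket_ext_nth_1:
  "fps_nth (bracket_ext m f g) 1 =
     m 1 (fps_nth f 0) (fps_nth g 0) + m 0 (fps_nth f 0) (fps_nth g 1)
     + m 0 (fps_nth f 1) (fps_nth g 0)"
  by (simp add: bracket_ext_def atMost_Suc algebra_simps)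

lemma linear_ext_nth_0: "fps_nth (linear_ext \<phi> f) 0 = \<phi> 0 (fps_nth f 0)"
  by (simp add: linear_ext_def)

lemma linear_ext_nth_1:
  "fps_nth (linear_ext \<phi> f) 1 = \<phi> 1 (fps_nth f 0) + \<phi> 0 (fps_nth f 1)"
  by (simp add: linear_ext_def atMost_Suc algebra_simps)

lemma bracket_ext_zero:
  assumes "\<And>i. bilinear_map scale (m i)"
  shows "bracket_ext m 0 f = 0" "bracket_ext m f 0 = 0"
  by (auto simp: bracket_ext_def fps_eq_iff bilinear_map_zero[OF assms])

lemma ad_power_mod_t2:
  fixes m :: "nat \<Rightarrow> 'b::ab_group_add \<Rightarrow> 'b \<Rightarrow> 'b" and x :: 'b and u :: "'b fps"
  assumes alt: "\<And>i. alternating_bilinear scale (m i)"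
  defines "P \<equiv> \<lambda>n. (poly_bracket (bracket_ext m)
    (monom (fps_const x) 1 + [:t_power_mult 1 u:]) ^^ Suc n) [:fps_const x:]"
  shows "fps_nth (coeff (P n) i) 0 = 0 \<and>
    fps_nth (coeff (P n) i) 1 = (if i = n then (m 0 x ^^ n) (m 0 (fps_nth u 0) x) else 0)"
proof (induction n arbitrary: i)
  case 0
  have bil: "bilinear_map scale (m i)" and [simp]: "m i x x = 0" for i x
    using alt by (auto simp: alternating_bilinear_def)
  note [simp] = bilinear_map_zero[OF bil]
  have "P 0 = poly_bracket (bracket_ext m)
      (monom (fps_const x) 1 + [:t_power_mult 1 u:]) [:fps_const x:]"
    by (simp add: P_def)
  \<comment> \<open>Bracketing with Z x gives m_t(x, x), which is 0 because every \<open>m i\<close>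
    is alternating. Bracketing with t u leaves t [u_0, x] modulo t^2, in degree 0 of Z.\<close>
  show ?case
    unfolding \<open>P 0 = _\<close> coeff_poly_bracket_linear[where B = "bracket_ext m", OF bracket_ext_zero[OF bil]]
    by (auto simp: bracket_ext_nth_0
        bracket_ext_nth_1[unfolded One_nat_def] coeff_pCons fps_nth_t_power_mult split: nat.splits)
next
  case (Suc n)
  have bil: "bilinear_map scale (m i)" for i
    using alt by (auto simp: alternating_bilinear_def)
  note [simp] = bilinear_map_zero[OF bil]
  have "P (Suc n) = poly_bracket (bracket_ext m)
      (monom (fps_const x) 1 + [:t_power_mult 1 u:]) (P n)"
    by (simp add: P_def)
  \<comment> \<open>All coefficients of \<open>P n\<close> are divisible by t, so bracketing with t
    u lands in t^2. Modulo t^2 only Z x acts, through \<open>m 0\<close>, and it raises the Z-degree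
    by one.\<close>
  show ?case
    unfolding \<open>P (Suc n) = _\<close> coeff_poly_bracket_linear[where B = "bracket_ext m", OF bracket_ext_zero[OF bil]]
    using Suc
    by (auto simp: bracket_ext_nth_0
        bracket_ext_nth_1[unfolded One_nat_def] fps_nth_t_power_mult)
qed

text \<open>Applied to f = \<phi>_t(x), whose coefficients of 1 and t are x and \<phi>_1(x), this
  produces the summand ad_x^(p-1) of \<open>ind1\<close>.\<close>

lemma omega_ext_nth_1:
  fixes scale :: "'a::field \<Rightarrow> 'b::ab_group_add \<Rightarrow> 'b"
  assumes vs: "vector_space scale" and char: "CHAR('a) = p" and p: "p \<ge> 2"
    and alt: "\<And>i. alternating_bilinear scale (m i)"
  shows "fps_nth (omega_ext p scale m \<omega> f) 1 =
    \<omega> 1 (fps_nth f 0) + (m 0 (fps_nth f 0) ^^ (p - 1)) (fps_nth f 1)"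
proof -
  interpret vector_space scale by (rule vs)
  define x where "x = fps_nth f 0"
  define u where "u = fps_shift 1 f"
  have f: "f = fps_const x + t_power_mult 1 u"
    by (auto simp: fps_eq_iff x_def u_def t_power_mult_def)
  have bil: "bilinear_map scale (m 0)"
    using alt by (simp add: alternating_bilinear_def)
  \<comment> \<open>With this \<open>q\<close>, the power \<open>p - 1\<close> in
    \<open>s_term\<close> has the form \<open>Suc q\<close> required by
    \<open>ad_power_mod_t2\<close>.\<close>
  define q where "q = p - 2"
  have q: "p = Suc (Suc q)"
    using p by (simp add: q_def)
  have "of_nat (p - 1) + 1 = (of_nat p :: 'a)"
    by (simp add: q)
  also have "\<dots> = 0"
    using of_nat_CHAR[where 'a = 'a] char by simp
  finally have "of_nat (p - 1) = (- 1 :: 'a)"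
    by (simp only: add_eq_0_iff2)
  then have inv: "1 / of_nat (p - 1) = (- 1 :: 'a)"
    by simp
  have minus: "(m 0 x ^^ n) (- v) = - (m 0 x ^^ n) v" for n v
    by (induction n) (simp_all add: bilinear_map_minus_right[OF bil])
  have s: "fps_nth (s_term p (fps_scale scale) (bracket_ext m) k (fps_const x) (t_power_mult 1 u)) 1
      = (if k = p - 1 then (m 0 x ^^ (p - 1)) (fps_nth u 0) else 0)" if "k \<in> {1..p-1}" for k
  proof -
    have "p - 1 = Suc q" and k: "k - 1 = q \<longleftrightarrow> k = p - 1"
      using that q by auto
    have "fps_nth (s_term p (fps_scale scale) (bracket_ext m) k (fps_const x) (t_power_mult 1 u)) 1
        = scale (1 / of_nat k) (if k - 1 = q then (m 0 x ^^ q) (m 0 (fps_nth u 0) x) else 0)"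
      unfolding s_term_def fps_scale_def fps_nth_Abs_fps \<open>p - 1 = Suc q\<close>
      by (subst conjunct2[OF ad_power_mod_t2[OF alt]]) (rule refl)
    \<comment> \<open>Two signs arise and cancel: one from 1/(p - 1) = -1, one from writing [u_0, x]
      as -[x, u_0].\<close>
    also have "\<dots> = (if k = p - 1 then - (m 0 x ^^ q) (- m 0 x (fps_nth u 0)) else 0)"
      unfolding k alternating_bilinear_skew[OF alt, of 0 "fps_nth u 0" x]
      using inv by auto
    also have "\<dots> = (if k = p - 1 then (m 0 x ^^ (p - 1)) (fps_nth u 0) else 0)"
      unfolding minus \<open>p - 1 = Suc q\<close> funpow_Suc_right o_apply by simp
    finally show ?thesis .
  qed
  \<comment> \<open>The summand t^p \<omega>_t(u) of the recursion has no coefficient at t, since p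
    is at least 2.\<close>
  have "fps_nth (omega_ext p scale m \<omega> f) 1 = \<omega> 1 x + (\<Sum>k=1..p-1. fps_nth
      (s_term p (fps_scale scale) (bracket_ext m) k (fps_const x) (t_power_mult 1 u)) 1)"
    unfolding f using p
    by (subst omega_ext_rec) (simp_all add: fps_nth_t_power_mult fps_sum_nth omega_series_def)
  also have "\<dots> = \<omega> 1 x
      + (\<Sum>k=1..p-1. if k = p - 1 then (m 0 x ^^ (p - 1)) (fps_nth u 0) else 0)"
    by (simp only: s cong: sum.cong)
  also have "\<dots> = \<omega> 1 x + (m 0 x ^^ (p - 1)) (fps_nth u 0)"
    by (simp add: q)
  finally show ?thesis
    by (simp add: x_def u_def)
qed

lemma restricted_deformation_alternating:
  assumes "restricted_lie_algebra scale br p pmap" "restricted_deformation p scale br pmap m \<omega>"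
  shows "alternating_bilinear scale (m i)"
proof (cases i)
  case 0
  then show ?thesis
    using assms lie_algebra.alternating
    by (metis restricted_deformation_def restricted_lie_algebra.axioms(1))
next
  case (Suc j)
  then show ?thesis
    using assms(2) by (auto simp: restricted_deformation_def restricted_cochains2_def)
qed

theorem theorem3p6:
  fixes scale :: "'a::field \<Rightarrow> 'b::ab_group_add \<Rightarrow> 'b"
    and br :: "'b \<Rightarrow> 'b \<Rightarrow> 'b" and pmap :: "'b \<Rightarrow> 'b" and p :: nat
    and m m' :: "nat \<Rightarrow> 'b \<Rightarrow> 'b \<Rightarrow> 'b" and \<omega> \<omega>' :: "nat \<Rightarrow> 'b \<Rightarrow> 'b"
  assumes "CHAR('a) = p" and "p \<ge> 3"
    and "restricted_lie_algebra scale br p pmap"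
    and "restricted_deformation p scale br pmap m \<omega>"
    and "restricted_deformation p scale br pmap m' \<omega>'"
    and "equivalent_deformations p scale m \<omega> m' \<omega>'"
  shows "(\<lambda>x y. m' 1 x y - m 1 x y, \<lambda>x. \<omega>' 1 x - \<omega> 1 x)
           \<in> restricted_coboundaries2 p scale br pmap"
proof -
  have vs: "vector_space scale"
    using assms(3) by (simp add: restricted_lie_algebra_def lie_algebra_def)
  interpret vector_space scale by (rule vs)
  note alt' = restricted_deformation_alternating[OF assms(3,5)]
  have 0 [simp]: "m 0 = br" "m' 0 = br" "\<omega> 0 = pmap"
    using assms(4,5) by (simp_all add: restricted_deformation_def)
  have br_alt: "alternating_bilinear scale br"
    using alt'[of 0] by simp
  then have bil: "bilinear_map scale br"
    by (simp add: alternating_bilinear_def)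
  obtain \<phi> :: "nat \<Rightarrow> 'b \<Rightarrow> 'b" where lin: "\<And>i. Vector_Spaces.linear scale scale (\<phi> i)"
    and [simp]: "\<phi> 0 = id"
    and m_eq: "\<And>x y. bracket_ext m' (linear_ext \<phi> (fps_const x)) (linear_ext \<phi> (fps_const y)) =
           linear_ext \<phi> (bracket_ext m (fps_const x) (fps_const y))"
    and \<omega>_eq: "\<And>x. omega_ext p scale m' \<omega>' (linear_ext \<phi> (fps_const x)) =
           linear_ext \<phi> (omega_series \<omega> x)"
    using assms(6) by (auto simp: equivalent_deformations_def)
  define \<psi> where "\<psi> = (\<lambda>x. - \<phi> 1 x)"
  have "Vector_Spaces.linear scale scale \<psi>"
    using lin[of 1] by (simp add: \<psi>_def linear_iff_module_hom module_hom_iff scale_minus_right)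
  moreover have "m' 1 x y - m 1 x y = d1_CE br \<psi> x y" for x y
  proof -
    have "m' 1 x y + br x (\<phi> 1 y) + br (\<phi> 1 x) y = \<phi> 1 (br x y) + m 1 x y"
      using arg_cong[OF m_eq[of x y], of "\<lambda>f. fps_nth f 1"]
      unfolding bracket_ext_nth_1 linear_ext_nth_1 linear_ext_nth_0 bracket_ext_nth_0
      by (simp add: bilinear_map_zero[OF bil])
    then show ?thesis
      \<comment> \<open>Skew-symmetry rewrites [\<phi>_1(x), y] as -[y, \<phi>_1(x)], the order used
        in \<open>d1_CE\<close>.\<close>
      unfolding d1_CE_def \<psi>_def bilinear_map_minus_right[OF bil]
        alternating_bilinear_skew[OF br_alt, of "\<phi> 1 x" y]
      by (simp add: algebra_simps)
  qed
  moreover have "\<omega>' 1 x - \<omega> 1 x = ind1 p br pmap \<psi> x" for x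
  proof -
    have "2 \<le> p"
      using assms(2) by simp
    from omega_ext_nth_1[OF vs assms(1) this, where m = m' and \<omega> = \<omega>' and f = "linear_ext \<phi> (fps_const x)", OF alt']
    have "\<omega>' 1 x + (br x ^^ (p - 1)) (\<phi> 1 x) = \<phi> 1 (pmap x) + \<omega> 1 x"
      unfolding \<omega>_eq linear_ext_nth_1 linear_ext_nth_0 by (simp add: omega_series_def)
    \<comment> \<open>Oddness of the powers of ad_x lets the sign in \<psi> = -\<phi>_1 be pulled
      out.\<close>
    moreover have "(br x ^^ n) (- v) = - (br x ^^ n) v" for n v
      by (induction n) (simp_all add: bilinear_map_minus_right[OF bil])
    ultimately show ?thesis
      by (simp add: ind1_def \<psi>_def algebra_simps)
  qed
  ultimately show ?thesis
    unfolding restricted_coboundaries2_def by blast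
qed

end
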